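(* Let a strict (non-barotropic) and non-isoenergetic thermodynamic Stephani universe be given, with data $\epsilon\in\{1,0,-1\}$, $R(t)$, $K(t)$, energy density $\rho$ and pressure $p$ as described in the context. Regard $K$ and $\rho$ as functions of $R$, let a prime denote $d/dR$, and set $a(R)=-\dfrac{R\rho'}{3\rho}$. Let $\pi=p/\rho$ and $\chi=\dot p/\dot\rho$ be the associated space-time functions. Then the ideal gas hydrodynamic condition $d\chi\wedge d\pi=0$ holds if and only if the functions $\rho(R)$ and $K(R)$ satisfy $$a''-\frac{2a'^2}{a}=a'\,\frac{K''}{K'},\qquad K'''-K''\left(\frac{K''}{K'}-\frac1R\right)=2K''\,\frac{a'}{a}.$$ Thus the universes satisfying the condition are exactly those obtained from a solution $(\rho(R),K(R))$ of these two equations (with $\rho,\rho',K'$ non-vanishing) by taking for $R(t)$ a solution with $dR/dt\neq0$ of the generalized Friedmann equation $$\rho(R)=\frac{3}{R^2}\left(\frac{dR}{dt}\right)^2+\frac{3}{R^2}\left[\epsilon-K^2(R)\right].$$ Moreover, when the condition holds, the indicatrix function is of the form $$\chi(\pi)=\alpha\pi^2+\gamma\pi+\beta$$ for some real constants $\alpha,\beta,\gamma$ satisfying $\alpha+\beta=\gamma-\tfrac23$.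
   Context: Thermodynamic Stephani universes. Let $\epsilon\in\{1,0,-1\}$, and let $R(t)>0$ and $K(t)$ be smooth functions on an open interval with $dR/dt\neq 0$ everywhere (non-zero expansion). In coordinates $(t,x^1,x^2,x^3)=(t,x,y,z)$, with $r^2=x^2+y^2+z^2$, put $$w=\frac{z}{1+\frac{\epsilon}{4}r^2},\qquad L=\frac{R(t)}{1+K(t)\,w},\qquad \Omega=\frac{w}{z}\,L=\frac{L}{1+\frac{\epsilon}{4}r^2},\qquad N=R\,\partial_R\ln L .$$ Since $dR/dt\ne0$, every function of $t$ may be viewed as a function of $R$; $\partial_R$ is the derivative with respect to $R$ at fixed $(x,y,z)$, with $K=K(R)$, so that $N=1-\dfrac{RK'w}{1+Kw}$, where a prime denotes $d/dR$. The metric is $$ds^2=-N^2dt^2+\Omega^2\,\delta_{ij}\,dx^idx^j$$ on a connected open domain where $1+\frac{\epsilon}{4}r^2$, $1+Kw$ and $N$ do not vanish. It is a perfect fluid solution of the Einstein equations with unit velocity $u=\frac1N\partial_t$, energy density and pressure $$\rho=\frac{3}{R^2}\left(\frac{dR}{dt}\right)^2+\frac{3}{R^2}(\epsilon-K^2),\qquad p=-\rho-\frac{R}{3}\,\frac{\partial_R\rho}{N}.$$ In particular $\rho$ depends only on $t$, i.e. $\rho=\rho(R)$. For a space-time function $f$ write $\dot f=u(f)=\frac1N\partial_t f$. Then $\chi=\dot p/\dot\rho$ is called the indicatrix function. "Strict (non-barotropic)" means $K'(R)\ne0$, and "non-isoenergetic" means $\dot\rho\neq0$ (i.e. $\rho'(R)\ne0$),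 both everywhere; $\rho\neq0$ everywhere is also assumed so that $\pi=p/\rho$ is defined. Ideal gas hydrodynamic condition: $d\chi\wedge d\pi=0$ on the space-time. (By a known hydrodynamic characterization, a non-barotropic, non-isoenergetic divergence-free perfect fluid energy tensor represents the evolution in local thermal equilibrium of an ideal gas with equation of state $p=krT$ exactly when $\chi$ is a function of $\pi$ with $\chi\ne\pi$, i.e. $d\chi\wedge d\pi=0$, $\chi\neq\pi$.) *)

theory Defs
  imports "HOL-Analysis.Analysis"
begin

text \<open>
  A space-time point is a pair \<open>(t, x)\<close> of a time \<open>t\<close> and a vector \<open>x\<close> of \<open>\<real>\<^sup>3\<close> whose
  components \<open>x $ 1\<close>, \<open>x $ 2\<close>, \<open>x $ 3\<close> are the coordinates \<open>x\<close>, \<open>y\<close>, \<open>z\<close>; so \<open>r = norm x\<close>.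
\<close>

type_synonym event = "real \<times> (real ^ 3)"

text \<open>\<open>C\<^sup>\<infinity>\<close> functions on an open set of reals.\<close>

definition smooth_on :: "real set \<Rightarrow> (real \<Rightarrow> real) \<Rightarrow> bool" where
  "smooth_on S f \<longleftrightarrow> (\<forall>n. \<forall>x\<in>S. (deriv ^^ n) f differentiable (at x))"

text \<open>
  Since \<open>dR/dt \<noteq> 0\<close> on the interval \<open>I\<close>, the map \<open>R\<close> is injective on \<open>I\<close>, and \<open>the_inv_into I R\<close>
  is the function \<open>t(R)\<close>.  A function \<open>f\<close> of \<open>t\<close> becomes the function \<open>f(t(R))\<close> of \<open>R\<close>, and a prime
  is the ordinary derivative of the latter.
\<close>

definition as_fun_of_R :: "real set \<Rightarrow> (real \<Rightarrow> real) \<Rightarrow> (real \<Rightarrow> real) \<Rightarrow> real \<Rightarrow> real" where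
  "as_fun_of_R I R f = (\<lambda>s. f (the_inv_into I R s))"

text \<open>\<open>\<partial>f/\<partial>R\<close> and \<open>\<partial>f/\<partial>t\<close> at fixed \<open>(x, y, z)\<close>.\<close>

definition partial_R :: "real set \<Rightarrow> (real \<Rightarrow> real) \<Rightarrow> (event \<Rightarrow> real) \<Rightarrow> event \<Rightarrow> real" where
  "partial_R I R f q = deriv (as_fun_of_R I R (\<lambda>t. f (t, snd q))) (R (fst q))"

definition partial_t :: "(event \<Rightarrow> real) \<Rightarrow> event \<Rightarrow> real" where
  "partial_t f q = deriv (\<lambda>t. f (t, snd q)) (fst q)"


section \<open>Stephani universes\<close>

definition conf :: "real \<Rightarrow> real ^ 3 \<Rightarrow> real" where
  "conf \<epsilon> x = 1 + \<epsilon> / 4 * (norm x)\<^sup>2"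

definition w_coord :: "real \<Rightarrow> real ^ 3 \<Rightarrow> real" where
  "w_coord \<epsilon> x = x $ 3 / conf \<epsilon> x"

definition L_fun :: "real \<Rightarrow> (real \<Rightarrow> real) \<Rightarrow> (real \<Rightarrow> real) \<Rightarrow> event \<Rightarrow> real" where
  "L_fun \<epsilon> R K q = R (fst q) / (1 + K (fst q) * w_coord \<epsilon> (snd q))"

definition Omega :: "real \<Rightarrow> (real \<Rightarrow> real) \<Rightarrow> (real \<Rightarrow> real) \<Rightarrow> event \<Rightarrow> real" where
  "Omega \<epsilon> R K q = L_fun \<epsilon> R K q / conf \<epsilon> (snd q)"

text \<open>
  \<open>N = R \<partial>\<^sub>R ln L\<close>.  The function \<open>L\<close> may be negative, whence the absolute value; see
  \<open>lapse_eq\<close> below for the explicit form.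
\<close>

definition lapse ::
  "real \<Rightarrow> real set \<Rightarrow> (real \<Rightarrow> real) \<Rightarrow> (real \<Rightarrow> real) \<Rightarrow> event \<Rightarrow> real" where
  "lapse \<epsilon> I R K q = R (fst q) * partial_R I R (\<lambda>q. ln \<bar>L_fun \<epsilon> R K q\<bar>) q"

text \<open>The metric \<open>-N\<^sup>2 dt\<^sup>2 + \<Omega>\<^sup>2 \<delta>\<^sub>i\<^sub>j dx\<^sup>i dx\<^sup>j\<close> and the velocity \<open>u = N\<^sup>-\<^sup>1 \<partial>\<^sub>t\<close>.\<close>

definition stephani_metric ::
  "real \<Rightarrow> real set \<Rightarrow> (real \<Rightarrow> real) \<Rightarrow> (real \<Rightarrow> real) \<Rightarrow> event \<Rightarrow> event \<Rightarrow> event \<Rightarrow> real" where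
  "stephani_metric \<epsilon> I R K q X Y =
     - (lapse \<epsilon> I R K q)\<^sup>2 * (fst X * fst Y) + (Omega \<epsilon> R K q)\<^sup>2 * (snd X \<bullet> snd Y)"

definition velocity ::
  "real \<Rightarrow> real set \<Rightarrow> (real \<Rightarrow> real) \<Rightarrow> (real \<Rightarrow> real) \<Rightarrow> event \<Rightarrow> event" where
  "velocity \<epsilon> I R K q = (1 / lapse \<epsilon> I R K q, 0)"

lemma velocity_unit:
  "lapse \<epsilon> I R K q \<noteq> 0 \<Longrightarrow>
     stephani_metric \<epsilon> I R K q (velocity \<epsilon> I R K q) (velocity \<epsilon> I R K q) = -1"
  by (simp add: stephani_metric_def velocity_def power2_eq_square)

text \<open>
  The time interval \<open>I\<close> is the range of the coordinate \<open>t\<close> on the space-time domain \<open>D\<close>; a larger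
  interval of definition of \<open>R\<close> and \<open>K\<close> would carry no information about the space-time.
\<close>

definition stephani_domain ::
  "real \<Rightarrow> real set \<Rightarrow> (real \<Rightarrow> real) \<Rightarrow> (real \<Rightarrow> real) \<Rightarrow> event set \<Rightarrow> bool" where
  "stephani_domain \<epsilon> I R K D \<longleftrightarrow>
     open D \<and> connected D \<and> D \<noteq> {} \<and> fst ` D = I \<and>
     (\<forall>q\<in>D. conf \<epsilon> (snd q) \<noteq> 0 \<and>
            1 + K (fst q) * w_coord \<epsilon> (snd q) \<noteq> 0 \<and>
            lapse \<epsilon> I R K q \<noteq> 0)"

definition stephani_universe ::
  "real \<Rightarrow> real set \<Rightarrow> (real \<Rightarrow> real) \<Rightarrow> (real \<Rightarrow> real) \<Rightarrow> event set \<Rightarrow> bool" where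
  "stephani_universe \<epsilon> I R K D \<longleftrightarrow>
     \<epsilon> \<in> {1, 0, -1} \<and>
     open I \<and> is_interval I \<and>
     smooth_on I R \<and> smooth_on I K \<and>
     (\<forall>t\<in>I. R t > 0 \<and> deriv R t \<noteq> 0) \<and>
     stephani_domain \<epsilon> I R K D"


section \<open>Energy density, pressure, indicatrix function\<close>

definition energy_density :: "real \<Rightarrow> (real \<Rightarrow> real) \<Rightarrow> (real \<Rightarrow> real) \<Rightarrow> real \<Rightarrow> real" where
  "energy_density \<epsilon> R K t = 3 / (R t)\<^sup>2 * (deriv R t)\<^sup>2 + 3 / (R t)\<^sup>2 * (\<epsilon> - (K t)\<^sup>2)"

definition rho :: "real \<Rightarrow> (real \<Rightarrow> real) \<Rightarrow> (real \<Rightarrow> real) \<Rightarrow> event \<Rightarrow> real" where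
  "rho \<epsilon> R K q = energy_density \<epsilon> R K (fst q)"

definition pressure ::
  "real \<Rightarrow> real set \<Rightarrow> (real \<Rightarrow> real) \<Rightarrow> (real \<Rightarrow> real) \<Rightarrow> event \<Rightarrow> real" where
  "pressure \<epsilon> I R K q =
     - rho \<epsilon> R K q - R (fst q) / 3 * (partial_R I R (rho \<epsilon> R K) q / lapse \<epsilon> I R K q)"

text \<open>\<open>u(f)\<close>\<close>

definition udot ::
  "real \<Rightarrow> real set \<Rightarrow> (real \<Rightarrow> real) \<Rightarrow> (real \<Rightarrow> real) \<Rightarrow> (event \<Rightarrow> real) \<Rightarrow> event \<Rightarrow> real" where
  "udot \<epsilon> I R K f q = 1 / lapse \<epsilon> I R K q * partial_t f q"

definition pi_fun ::
  "real \<Rightarrow> real set \<Rightarrow> (real \<Rightarrow> real) \<Rightarrow> (real \<Rightarrow> real) \<Rightarrow> event \<Rightarrow> real" where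
  "pi_fun \<epsilon> I R K q = pressure \<epsilon> I R K q / rho \<epsilon> R K q"

definition chi_fun ::
  "real \<Rightarrow> real set \<Rightarrow> (real \<Rightarrow> real) \<Rightarrow> (real \<Rightarrow> real) \<Rightarrow> event \<Rightarrow> real" where
  "chi_fun \<epsilon> I R K q =
     udot \<epsilon> I R K (pressure \<epsilon> I R K) q / udot \<epsilon> I R K (rho \<epsilon> R K) q"

text \<open>Strict (non-barotropic) and non-isoenergetic, with \<open>\<rho>\<close> nowhere zero.\<close>

definition strict_nonisoenergetic_universe ::
  "real \<Rightarrow> real set \<Rightarrow> (real \<Rightarrow> real) \<Rightarrow> (real \<Rightarrow> real) \<Rightarrow> event set \<Rightarrow> bool" where
  "strict_nonisoenergetic_universe \<epsilon> I R K D \<longleftrightarrow>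
     stephani_universe \<epsilon> I R K D \<and>
     (\<forall>s\<in>R ` I. deriv (as_fun_of_R I R K) s \<noteq> 0) \<and>
     (\<forall>q\<in>D. udot \<epsilon> I R K (rho \<epsilon> R K) q \<noteq> 0) \<and>
     (\<forall>q\<in>D. rho \<epsilon> R K q \<noteq> 0)"


section \<open>The ideal gas condition\<close>

definition wedge :: "(event \<Rightarrow> real) \<Rightarrow> (event \<Rightarrow> real) \<Rightarrow> event \<Rightarrow> event \<Rightarrow> real" where
  "wedge \<alpha> \<beta> X Y = \<alpha> X * \<beta> Y - \<alpha> Y * \<beta> X"

definition ideal_gas_condition ::
  "real \<Rightarrow> real set \<Rightarrow> (real \<Rightarrow> real) \<Rightarrow> (real \<Rightarrow> real) \<Rightarrow> event set \<Rightarrow> bool" where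
  "ideal_gas_condition \<epsilon> I R K D \<longleftrightarrow>
     (\<forall>q\<in>D. \<forall>X Y. wedge (frechet_derivative (chi_fun \<epsilon> I R K) (at q))
                        (frechet_derivative (pi_fun \<epsilon> I R K) (at q)) X Y = 0)"

definition a_fun :: "(real \<Rightarrow> real) \<Rightarrow> real \<Rightarrow> real" where
  "a_fun \<rho> = (\<lambda>s. - (s * deriv \<rho> s / (3 * \<rho> s)))"

text \<open>The two differential equations, for \<open>\<rho>\<close> and \<open>\<kappa> = K\<close> as functions of \<open>s = R\<close>.\<close>

definition ideal_gas_equations :: "real set \<Rightarrow> (real \<Rightarrow> real) \<Rightarrow> (real \<Rightarrow> real) \<Rightarrow> bool" where
  "ideal_gas_equations J \<rho> \<kappa> \<longleftrightarrow>
     (\<forall>s\<in>J.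
        let a = a_fun \<rho> s; a' = deriv (a_fun \<rho>) s; a'' = deriv (deriv (a_fun \<rho>)) s;
            K' = deriv \<kappa> s; K'' = deriv (deriv \<kappa>) s; K''' = deriv (deriv (deriv \<kappa>)) s
        in a'' - 2 * a'\<^sup>2 / a = a' * (K'' / K') \<and>
           K''' - K'' * (K'' / K' - 1 / s) = 2 * K'' * (a' / a))"

text \<open>
  The universe with data \<open>\<epsilon>, R, K\<close> arises from a solution \<open>(\<rho>, \<kappa>)\<close> of the equations on an interval
  of positive values of \<open>R\<close>, by taking for \<open>R(t)\<close> a solution of the generalized Friedmann
  equation with \<open>dR/dt \<noteq> 0\<close> and \<open>K(t) = \<kappa>(R(t))\<close>.
\<close>

definition obtained_from_solution ::
  "real \<Rightarrow> real set \<Rightarrow> (real \<Rightarrow> real) \<Rightarrow> (real \<Rightarrow> real) \<Rightarrow> event set \<Rightarrow> bool" where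
  "obtained_from_solution \<epsilon> I R K D \<longleftrightarrow>
     \<epsilon> \<in> {1, 0, -1} \<and>
     (\<exists>J \<rho> \<kappa>.
        open J \<and> is_interval J \<and> J \<subseteq> {0<..} \<and>
        smooth_on J \<rho> \<and> smooth_on J \<kappa> \<and>
        (\<forall>s\<in>J. \<rho> s \<noteq> 0 \<and> deriv \<rho> s \<noteq> 0 \<and> deriv \<kappa> s \<noteq> 0) \<and>
        ideal_gas_equations J \<rho> \<kappa> \<and>
        open I \<and> is_interval I \<and> smooth_on I R \<and> R ` I \<subseteq> J \<and>
        (\<forall>t\<in>I. deriv R t \<noteq> 0 \<and>
               \<rho> (R t) = 3 / (R t)\<^sup>2 * (deriv R t)\<^sup>2 + 3 / (R t)\<^sup>2 * (\<epsilon> - (\<kappa> (R t))\<^sup>2) \<and>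
               K t = \<kappa> (R t))) \<and>
     stephani_domain \<epsilon> I R K D"

section \<open>The lapse function in explicit form\<close>

lemma smooth_on_DERIV:
  assumes "smooth_on S f" "x \<in> S"
  shows "(f has_real_derivative deriv f x) (at x)"
proof -
  have "(deriv ^^ 0) f differentiable (at x)"
    using assms unfolding smooth_on_def by blast
  then show ?thesis
    by (simp add: DERIV_deriv_iff_real_differentiable)
qed

lemma stephani_inj_on:
  assumes "stephani_universe \<epsilon> I R K D"
  shows "inj_on R I"
proof -
  have I: "is_interval I" and R: "smooth_on I R" and nz: "\<forall>t\<in>I. deriv R t \<noteq> 0"
    using assms by (auto simp: stephani_universe_def)
  have False if xy: "x \<in> I" "y \<in> I" "x < y" "R x = R y" for x y
  proof -
    have sub: "{x..y} \<subseteq> I"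
      using I xy by (meson atLeastAtMost_iff is_interval_1 subsetI)
    have "\<exists>z. z > x \<and> z < y \<and> R y - R x = (y - x) * deriv R z"
      using xy sub by (intro MVT2 smooth_on_DERIV[OF R]) auto
    then obtain z where "x < z" "z < y" "(y - x) * deriv R z = 0"
      using xy by auto
    moreover have "z \<in> I"
      using sub \<open>x < z\<close> \<open>z < y\<close> by auto
    ultimately show False
      using nz by simp
  qed
  then show ?thesis
    by (metis inj_onI linorder_neqE_linordered_idom)
qed

lemma DERIV_t_of_R:
  assumes "stephani_universe \<epsilon> I R K D" "t \<in> I"
  shows "(the_inv_into I R has_real_derivative inverse (deriv R t)) (at (R t))"
proof -
  have I: "open I" and R: "smooth_on I R" and nz: "deriv R t \<noteq> 0"
    using assms by (auto simp: stephani_universe_def)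
  have cont: "continuous_on I R"
    using smooth_on_DERIV[OF R] by (intro DERIV_continuous_on) (auto intro: DERIV_subset)
  have g: "the_inv_into I R (R x) = x" if "x \<in> I" for x
    using stephani_inj_on[OF assms(1)] that by (rule the_inv_into_f_f)
  show ?thesis
    unfolding has_field_derivative_def
  proof (rule has_derivative_inverse_strong[OF I assms(2) cont g])
    show "(R has_derivative (*) (deriv R t)) (at t)"
      using smooth_on_DERIV[OF R assms(2)] by (simp add: has_field_derivative_def)
    show "(*) (deriv R t) \<circ> (*) (inverse (deriv R t)) = id"
      using nz by (auto simp: fun_eq_iff)
  qed
qed

lemma lapse_eq:
  assumes U: "stephani_universe \<epsilon> I R K D" and q: "q \<in> D"
  shows "lapse \<epsilon> I R K q =
    1 - R (fst q) * deriv (as_fun_of_R I R K) (R (fst q)) * w_coord \<epsilon> (snd q)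
          / (1 + K (fst q) * w_coord \<epsilon> (snd q))"
proof -
  define t where "t = fst q"
  define w where "w = w_coord \<epsilon> (snd q)"
  define g where "g = the_inv_into I R"
  define k where "k = deriv (as_fun_of_R I R K) (R t)"
  have t: "t \<in> I"
    using U q by (auto simp: stephani_universe_def stephani_domain_def t_def)
  have R: "smooth_on I R" and K: "smooth_on I K" and pos: "R t > 0" and nz: "deriv R t \<noteq> 0"
    using U t by (auto simp: stephani_universe_def)
  have gt: "g (R t) = t"
    unfolding g_def using stephani_inj_on[OF U] t by (rule the_inv_into_f_f)
  have dg: "(g has_real_derivative inverse (deriv R t)) (at (R t))"
    unfolding g_def using U t by (rule DERIV_t_of_R)
  have "((\<lambda>s. K (g s)) has_real_derivative deriv K t * inverse (deriv R t)) (at (R t))"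
    using DERIV_chain2[OF _ dg] smooth_on_DERIV[OF K t] gt by simp
  then have dK: "((\<lambda>s. K (g s)) has_real_derivative k) (at (R t))"
    by (simp add: k_def as_fun_of_R_def g_def DERIV_imp_deriv)
  have dR: "((\<lambda>s. R (g s)) has_real_derivative 1) (at (R t))"
    using DERIV_chain2[OF _ dg, of R "deriv R t"] smooth_on_DERIV[OF R t] gt nz by simp
  have w0: "1 + K t * w \<noteq> 0"
    using U q by (auto simp: stephani_universe_def stephani_domain_def t_def w_def)
  have dL: "((\<lambda>s. R (g s) / (1 + K (g s) * w)) has_real_derivative
              ((1 + K t * w) - R t * (k * w)) / (1 + K t * w)\<^sup>2) (at (R t))"
    using w0 by (auto intro!: derivative_eq_intros dR dK simp: gt power2_eq_square)
  have "((\<lambda>s. ln (R (g s) / (1 + K (g s) * w))) has_real_derivative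
          ((1 + K t * w) - R t * (k * w)) / (1 + K t * w)\<^sup>2 / (R t / (1 + K t * w))) (at (R t))"
  proof -
    have "(ln has_real_derivative inverse (R t / (1 + K t * w))) (at (R t / (1 + K t * w)))"
    proof (cases "R t / (1 + K t * w) > 0")
      case True
      then show ?thesis by (rule DERIV_ln)
    next
      case False
      moreover have "R t / (1 + K t * w) \<noteq> 0"
        using pos w0 by simp
      ultimately have neg: "- (R t / (1 + K t * w)) > 0"
        by linarith
      have "((\<lambda>y. ln (- y)) has_real_derivative
              inverse (- (R t / (1 + K t * w))) * (- 1)) (at (R t / (1 + K t * w)))"
        using neg by (intro DERIV_chain2[where f = ln] DERIV_ln) (auto intro!: derivative_eq_intros)
      then show ?thesis
        by (simp add: ln_minus)
    qed
    then have "(ln has_real_derivative inverse (R t / (1 + K t * w)))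
                 (at (R (g (R t)) / (1 + K (g (R t)) * w)))"
      by (simp only: gt)
    from DERIV_chain2[where f = ln, OF this dL] show ?thesis
      by (simp only: divide_inverse mult.commute)
  qed
  moreover have "as_fun_of_R I R (\<lambda>t. ln \<bar>L_fun \<epsilon> R K (t, snd q)\<bar>) =
                   (\<lambda>s. ln (R (g s) / (1 + K (g s) * w)))"
    by (auto simp: as_fun_of_R_def L_fun_def g_def w_def fun_eq_iff abs_if ln_minus
             simp flip: minus_divide_left)
  ultimately have "lapse \<epsilon> I R K q =
      R t * (((1 + K t * w) - R t * (k * w)) / (1 + K t * w)\<^sup>2 / (R t / (1 + K t * w)))"
    unfolding lapse_def partial_R_def t_def by (simp add: DERIV_imp_deriv)
  also have "\<dots> = 1 - R t * k * w / (1 + K t * w)"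
  proof -
    have "r * ((c - r * (k * w)) / c\<^sup>2 / (r / c)) = 1 - r * k * w / c"
      if "r \<noteq> 0" "c \<noteq> 0" for r c :: real
      using that by (simp add: power2_eq_square field_simps)
    then show ?thesis
      using pos w0 by simp
  qed
  finally show ?thesis
    by (simp add: t_def w_def k_def)
qed

end

theory Submission
  imports Defs
begin

text \<open>
  Write \<open>s = R\<close> and \<open>y = \<pi> + 1 = a / N\<close>.  The relation \<open>\<partial>\<^sub>s N = - (1 - N) N / s - (K'' / K') (1 - N)\<close>
  turns \<open>\<chi> = \<pi> + \<rho> \<partial>\<^sub>s \<pi> / \<rho>'\<close> into \<open>\<chi> = - 2 / 3 + B(s) y - A(s) y\<^sup>2\<close> with
  \<open>A = s K'' / (3 K' a\<^sup>2)\<close>.  Hence \<open>d\<chi> \<and> d\<pi> = (B' y - A' y\<^sup>2) ds \<and> d\<pi>\<close>.  At fixed \<open>s\<close> the value of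
  \<open>y \<noteq> 0\<close> still varies with \<open>z\<close>, so that the condition holds iff \<open>A' = B' = 0\<close>, and these are the
  two differential equations up to non-zero factors.  In that case \<open>A\<close> and \<open>B\<close> are constants, and
  \<open>\<chi>\<close> is quadratic in \<open>\<pi>\<close>.
\<close>

section \<open>Smooth functions on an open set of reals\<close>

text \<open>Iterated derivatives are controlled on \<open>S\<close> only, so the induction carries
  agreement on \<open>S\<close> with some member of \<open>P\<close>; openness of \<open>S\<close>
  passes derivatives across that agreement.\<close>

lemma smooth_on_coinduct:
  assumes S: "open S" and f: "P f"
    and step: "\<And>f. P f \<Longrightarrow> \<exists>g. P g \<and> (\<forall>x\<in>S. (f has_real_derivative g x) (at x))"
  shows "smooth_on S f"
proof -
  have eq: "\<exists>g. P g \<and> (\<forall>x\<in>S. (deriv ^^ n) f x = g x)" for n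
  proof (induction n)
    case 0
    then show ?case using f by auto
  next
    case (Suc n)
    then obtain g where g: "P g" "\<forall>x\<in>S. (deriv ^^ n) f x = g x" by blast
    obtain g' where g': "P g'" "\<forall>x\<in>S. (g has_real_derivative g' x) (at x)"
      using step[OF g(1)] by blast
    have "((deriv ^^ n) f has_real_derivative g' x) (at x)" if "x \<in> S" for x
      using has_field_derivative_transform_within_open[OF _ S that, of g "g' x" "(deriv ^^ n) f"]
        g(2) g'(2) that by simp
    then show ?case using g'(1) by (auto simp: DERIV_imp_deriv)
  qed
  show ?thesis
    unfolding smooth_on_def
  proof (intro allI ballI)
    fix n x assume x: "x \<in> S"
    obtain g where g: "P g" "\<forall>x\<in>S. (deriv ^^ n) f x = g x" using eq by blast
    obtain g' where g': "P g'" "\<forall>x\<in>S. (g has_real_derivative g' x) (at x)"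
      using step[OF g(1)] by blast
    have "((deriv ^^ n) f has_real_derivative g' x) (at x)"
      using has_field_derivative_transform_within_open[OF _ S x, of g "g' x" "(deriv ^^ n) f"]
        g(2) g'(2) x by simp
    then show "(deriv ^^ n) f differentiable at x"
      using real_differentiable_def by blast
  qed
qed

lemma smooth_on_deriv: "smooth_on S f \<Longrightarrow> smooth_on S (deriv f)"
  unfolding smooth_on_def by (metis comp_apply funpow_Suc_right)

lemma smooth_on_subset: "smooth_on S f \<Longrightarrow> T \<subseteq> S \<Longrightarrow> smooth_on T f"
  unfolding smooth_on_def by blast

lemma smooth_on_const: "smooth_on S (\<lambda>x. c)"
proof -
  have "(deriv ^^ n) (\<lambda>x. c) = (\<lambda>x. if n = 0 then c else 0)" for n
    by (induction n) auto
  then show ?thesis by (simp add: smooth_on_def)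
qed

lemma smooth_on_ident: "smooth_on S (\<lambda>x. x)"
proof -
  have "smooth_on UNIV (\<lambda>x. x)"
  proof (rule smooth_on_coinduct[where P = "\<lambda>f. \<exists>a b. f = (\<lambda>x. a * x + b)"])
    show "\<exists>a b. (\<lambda>x::real. x) = (\<lambda>x. a * x + b)"
      by (intro exI[of _ 1] exI[of _ 0]) simp
    fix f :: "real \<Rightarrow> real" assume "\<exists>a b. f = (\<lambda>x. a * x + b)"
    then obtain a b where "f = (\<lambda>x. a * x + b)" by blast
    then have "\<forall>x\<in>UNIV. (f has_real_derivative 0 * x + a) (at x)"
      by (auto intro!: derivative_eq_intros)
    then show "\<exists>g. (\<exists>a b. g = (\<lambda>x. a * x + b)) \<and> (\<forall>x\<in>UNIV. (f has_real_derivative g x) (at x))"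
      by blast
  qed simp
  then show ?thesis by (rule smooth_on_subset) simp
qed

text \<open>Functions built from smooth ones on \<open>S\<close> and from composites with
  \<open>g\<close> by ring operations and reciprocals. Once it contains the derivative of
  \<open>g\<close>, this class is closed under differentiation on an open \<open>S\<close> that
  \<open>g\<close> maps into \<open>T\<close>, as the coinduction requires; \<open>cong\<close>
  leaves the values off \<open>S\<close> free.\<close>

inductive smooth_alg :: "real set \<Rightarrow> real set \<Rightarrow> (real \<Rightarrow> real) \<Rightarrow> (real \<Rightarrow> real) \<Rightarrow> bool"
  for S T g where
  base: "smooth_on S f \<Longrightarrow> smooth_alg S T g f"
| comp: "smooth_on T f \<Longrightarrow> smooth_alg S T g (\<lambda>x. f (g x))"
| add: "smooth_alg S T g f1 \<Longrightarrow> smooth_alg S T g f2 \<Longrightarrow> smooth_alg S T g (\<lambda>x. f1 x + f2 x)"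
| mult: "smooth_alg S T g f1 \<Longrightarrow> smooth_alg S T g f2 \<Longrightarrow> smooth_alg S T g (\<lambda>x. f1 x * f2 x)"
| inverse: "smooth_alg S T g f \<Longrightarrow> \<forall>x\<in>S. f x \<noteq> 0 \<Longrightarrow> smooth_alg S T g (\<lambda>x. inverse (f x))"
| cong: "smooth_alg S T g f1 \<Longrightarrow> \<forall>x\<in>S. f2 x = f1 x \<Longrightarrow> smooth_alg S T g f2"

text \<open>
  Only the derivative of the inner function \<open>g\<close> is assumed to lie in the algebra, so that the
  lemma covers both smooth \<open>g\<close> and, with \<open>g' = 1 / (f' \<circ> g)\<close>, inverse functions \<open>g\<close>.
\<close>

lemma smooth_alg_smooth_on:
  assumes S: "open S" and ST: "\<And>x. x \<in> S \<Longrightarrow> g x \<in> T"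
    and g: "\<And>x. x \<in> S \<Longrightarrow> (g has_real_derivative g' x) (at x)"
    and g': "smooth_alg S T g g'" and f: "smooth_alg S T g f"
  shows "smooth_on S f"
proof (rule smooth_on_coinduct[where P = "smooth_alg S T g", OF S f])
  fix f assume "smooth_alg S T g f"
  then show "\<exists>f'. smooth_alg S T g f' \<and> (\<forall>x\<in>S. (f has_real_derivative f' x) (at x))"
  proof induction
    case (base f)
    then show ?case
      by (blast intro: smooth_alg.base smooth_on_deriv smooth_on_DERIV)
  next
    case (comp f)
    have "smooth_alg S T g (\<lambda>x. deriv f (g x) * g' x)"
      by (intro smooth_alg.mult smooth_alg.comp g' smooth_on_deriv comp)
    moreover have "((\<lambda>x. f (g x)) has_real_derivative deriv f (g x) * g' x) (at x)"
      if "x \<in> S" for x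
      using DERIV_chain2[OF smooth_on_DERIV[OF comp ST] g] that by blast
    ultimately show ?case by blast
  next
    case (add f1 f2)
    then obtain d1 d2 where "smooth_alg S T g d1" "\<forall>x\<in>S. (f1 has_real_derivative d1 x) (at x)"
      "smooth_alg S T g d2" "\<forall>x\<in>S. (f2 has_real_derivative d2 x) (at x)" by blast
    then show ?case
      by (intro exI[of _ "\<lambda>x. d1 x + d2 x"]) (auto intro: smooth_alg.add DERIV_add)
  next
    case (mult f1 f2)
    then obtain d1 d2 where "smooth_alg S T g d1" "\<forall>x\<in>S. (f1 has_real_derivative d1 x) (at x)"
      "smooth_alg S T g d2" "\<forall>x\<in>S. (f2 has_real_derivative d2 x) (at x)" by blast
    then show ?case
      by (intro exI[of _ "\<lambda>x. d1 x * f2 x + d2 x * f1 x"])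
        (use mult.hyps in \<open>auto simp: smooth_alg.add smooth_alg.mult DERIV_mult\<close>)
  next
    case (inverse f)
    then obtain d where d: "smooth_alg S T g d" "\<forall>x\<in>S. (f has_real_derivative d x) (at x)"
      by blast
    \<comment> \<open>Negation is not a constructor, so the minus sign enters as the constant factor
      \<open>- 1\<close>.\<close>
    have "smooth_alg S T g (\<lambda>x. - 1 * (inverse (f x) * d x * inverse (f x)))"
      by (intro smooth_alg.mult smooth_alg.inverse[OF inverse.hyps] d(1)
          smooth_alg.base[OF smooth_on_const])
    moreover have "((\<lambda>x. inverse (f x)) has_real_derivative
        - 1 * (inverse (f x) * d x * inverse (f x))) (at x)" if "x \<in> S" for x
      using DERIV_inverse'[of f "d x" x] d(2) inverse.hyps that by simp
    ultimately show ?case by blast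
  next
    case (cong f1 f2)
    then obtain d where "smooth_alg S T g d" "\<forall>x\<in>S. (f1 has_real_derivative d x) (at x)" by blast
    then show ?case
      using has_field_derivative_transform_within_open[OF _ S, of f1 _ _ f2] cong.hyps by auto
  qed
qed

text \<open>The identity has the constant derivative 1, so the arithmetic closure rules below come
  straight from the constructors.\<close>

lemma smooth_alg_ident: "open S \<Longrightarrow> smooth_alg S S (\<lambda>x. x) f \<Longrightarrow> smooth_on S f"
  using smooth_alg_smooth_on[of S "\<lambda>x. x" S "\<lambda>x. 1" f]
  by (auto intro: smooth_alg.base smooth_on_const)

lemma smooth_on_compose:
  assumes "open S" "smooth_on S g" "smooth_on T f" "g ` S \<subseteq> T"
  shows "smooth_on S (\<lambda>x. f (g x))"
proof (rule smooth_alg_smooth_on)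
  show "smooth_alg S T g (deriv g)"
    using assms by (intro smooth_alg.base smooth_on_deriv)
  show "smooth_alg S T g (\<lambda>x. f (g x))"
    using assms by (intro smooth_alg.comp)
qed (use assms smooth_on_DERIV in auto)

lemma smooth_on_cong: "open S \<Longrightarrow> smooth_on S f \<Longrightarrow> (\<And>x. x \<in> S \<Longrightarrow> g x = f x) \<Longrightarrow> smooth_on S g"
  by (rule smooth_alg_ident) (auto intro: smooth_alg.base smooth_alg.cong)

lemma smooth_on_add:
  "open S \<Longrightarrow> smooth_on S f \<Longrightarrow> smooth_on S g \<Longrightarrow> smooth_on S (\<lambda>x. f x + g x)"
  by (rule smooth_alg_ident) (simp_all add: smooth_alg.add smooth_alg.base)

lemma smooth_on_mult:
  "open S \<Longrightarrow> smooth_on S f \<Longrightarrow> smooth_on S g \<Longrightarrow> smooth_on S (\<lambda>x. f x * g x)"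
  by (rule smooth_alg_ident) (simp_all add: smooth_alg.mult smooth_alg.base)

lemma smooth_on_power:
  "open S \<Longrightarrow> smooth_on S f \<Longrightarrow> smooth_on S (\<lambda>x. f x ^ n)"
  by (induction n) (auto intro: smooth_on_mult smooth_on_const)

lemma smooth_on_minus:
  "open S \<Longrightarrow> smooth_on S f \<Longrightarrow> smooth_on S (\<lambda>x. - f x)"
  using smooth_on_mult[of S "\<lambda>x. - 1" f] by (simp add: smooth_on_const)

lemma smooth_on_diff:
  "open S \<Longrightarrow> smooth_on S f \<Longrightarrow> smooth_on S g \<Longrightarrow> smooth_on S (\<lambda>x. f x - g x)"
  using smooth_on_add[of S f "\<lambda>x. - g x"] by (simp add: smooth_on_minus)

lemma smooth_on_divide:
  "open S \<Longrightarrow> smooth_on S f \<Longrightarrow> smooth_on S g \<Longrightarrow> (\<And>x. x \<in> S \<Longrightarrow> g x \<noteq> 0) \<Longrightarrow>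
    smooth_on S (\<lambda>x. f x / g x)"
  unfolding divide_inverse
  by (rule smooth_alg_ident) (simp_all add: smooth_alg.mult smooth_alg.inverse smooth_alg.base)

text \<open>Intended for \<open>g\<close> the inverse function of \<open>r\<close>: its derivative
  is the reciprocal of a composite with \<open>g\<close>, hence in the algebra, and this bootstraps
  to all orders.\<close>

lemma smooth_on_compose_inverse:
  assumes "open S" "\<And>x. x \<in> S \<Longrightarrow> g x \<in> T" "smooth_on T r" "smooth_on T f"
    "\<And>x. x \<in> S \<Longrightarrow> (g has_real_derivative inverse (deriv r (g x))) (at x)"
    "\<And>y. y \<in> T \<Longrightarrow> deriv r y \<noteq> 0"
  shows "smooth_on S (\<lambda>x. f (g x))"
proof (rule smooth_alg_smooth_on)
  show "smooth_alg S T g (\<lambda>x. inverse (deriv r (g x)))"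
    using assms by (intro smooth_alg.inverse smooth_alg.comp smooth_on_deriv) auto
  show "smooth_alg S T g (\<lambda>x. f (g x))"
    using assms by (intro smooth_alg.comp)
qed (use assms in auto)

lemma deriv_eq_on_open:
  assumes "open S" "\<And>x. x \<in> S \<Longrightarrow> f x = g x" "x \<in> S"
  shows "deriv f x = deriv g x"
  using assms by (intro deriv_cong_ev refl) (auto simp: eventually_nhds)

text \<open>Openness of \<open>J\<close> carries the agreement from each function to its derivative,
  one order at a time.\<close>

lemma ideal_gas_equations_cong:
  assumes J: "open J" and \<rho>: "\<And>s. s \<in> J \<Longrightarrow> \<rho>1 s = \<rho>2 s" and \<kappa>: "\<And>s. s \<in> J \<Longrightarrow> \<kappa>1 s = \<kappa>2 s"
    and eqs: "ideal_gas_equations J \<rho>1 \<kappa>1"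
  shows "ideal_gas_equations J \<rho>2 \<kappa>2"
proof -
  note d = deriv_eq_on_open[OF J]
  have a: "a_fun \<rho>1 s = a_fun \<rho>2 s" if "s \<in> J" for s
    using d[of \<rho>1 \<rho>2] \<rho> that by (simp add: a_fun_def)
  note a' = d[of "a_fun \<rho>1" "a_fun \<rho>2", OF a]
  note a'' = d[of "deriv (a_fun \<rho>1)" "deriv (a_fun \<rho>2)", OF a']
  note k' = d[of \<kappa>1 \<kappa>2, OF \<kappa>]
  note k'' = d[of "deriv \<kappa>1" "deriv \<kappa>2", OF k']
  note k''' = d[of "deriv (deriv \<kappa>1)" "deriv (deriv \<kappa>2)", OF k'']
  show ?thesis
    using eqs by (simp add: ideal_gas_equations_def Let_def a a' a'' k' k'' k''')
qed

section \<open>The coordinate \<open>w\<close> along lines in the \<open>z\<close> direction\<close>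

lemma conf_line:
  "conf \<epsilon> (x + h *\<^sub>R axis 3 1) = conf \<epsilon> x + \<epsilon> / 4 * (2 * x $ 3 * h + h\<^sup>2)"
proof -
  have "(norm (x + h *\<^sub>R axis 3 1))\<^sup>2 = (norm x)\<^sup>2 + 2 * x $ 3 * h + h\<^sup>2"
    unfolding power2_norm_eq_inner
    by (simp add: inner_add_left inner_add_right inner_axis inner_axis_axis
        inner_commute[of "axis 3 1" x] power2_eq_square algebra_simps)
  then show ?thesis by (simp add: conf_def algebra_simps)
qed

text \<open>The numerator of \<open>\<partial>w/\<partial>z\<close>; it can vanish, but only on a nowhere dense set.\<close>

definition dw_num :: "real \<Rightarrow> real ^ 3 \<Rightarrow> real" where
  "dw_num \<epsilon> x = conf \<epsilon> x - \<epsilon> / 2 * (x $ 3)\<^sup>2"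

lemma DERIV_w_coord_line:
  assumes "conf \<epsilon> x \<noteq> 0"
  shows "((\<lambda>h. w_coord \<epsilon> (x + h *\<^sub>R axis 3 1)) has_real_derivative
           dw_num \<epsilon> x / (conf \<epsilon> x)\<^sup>2) (at 0)"
  using assms unfolding w_coord_def conf_line dw_num_def
  by (auto intro!: derivative_eq_intros simp: field_simps power2_eq_square)

lemma open_line_section:
  fixes U :: "(real ^ 3) set"
  assumes "open U" "x \<in> U"
  shows "\<exists>d>0. \<forall>h. \<bar>h\<bar> < d \<longrightarrow> x + h *\<^sub>R axis 3 1 \<in> U"
proof -
  obtain d where "d > 0" "ball x d \<subseteq> U" using assms open_contains_ball by blast
  moreover have "x + h *\<^sub>R axis 3 1 \<in> ball x d" if "\<bar>h\<bar> < d" for h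
    using that by (simp add: dist_norm)
  ultimately show ?thesis by blast
qed

text \<open>For \<epsilon> = 0 the value is 1 everywhere. Otherwise a shift by \<open>h\<close>
  along z adds a polynomial in \<open>h\<close> with at most two roots, so a zero can be left by an
  arbitrarily small step.\<close>

lemma exists_dw_num_nonzero:
  assumes U: "open U" "U \<noteq> {}"
  shows "\<exists>x\<in>U. dw_num \<epsilon> x \<noteq> 0"
proof -
  obtain x where x: "x \<in> U" using U by blast
  obtain d where d: "d > 0" "\<And>h. \<bar>h\<bar> < d \<Longrightarrow> x + h *\<^sub>R axis 3 1 \<in> U"
    using open_line_section[OF U(1) x] by blast
  have line: "dw_num \<epsilon> (x + h *\<^sub>R axis 3 1) = dw_num \<epsilon> x - \<epsilon> / 4 * (h * (2 * x $ 3 + h))" for h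
    unfolding dw_num_def conf_line by (simp add: power2_eq_square algebra_simps)
  \<comment> \<open>Besides 0 the only root is \<open>- 2 * x $ 3\<close>; the candidates
    \<open>d / 2\<close> and \<open>d / 4\<close> cannot both equal it.\<close>
  obtain h where h: "0 < h" "h < d" "2 * x $ 3 + h \<noteq> 0"
  proof (cases "2 * x $ 3 + d / 2 = 0")
    case True
    then show ?thesis using d(1) by (intro that[of "d / 4"]) auto
  next
    case False
    then show ?thesis using d(1) by (intro that[of "d / 2"]) auto
  qed
  show ?thesis
  proof (cases "\<epsilon> = 0 \<or> dw_num \<epsilon> x \<noteq> 0")
    case True
    then have "dw_num \<epsilon> x \<noteq> 0" by (auto simp: dw_num_def conf_def)
    then show ?thesis using x by blast
  next
    case False
    then have "dw_num \<epsilon> (x + h *\<^sub>R axis 3 1) \<noteq> 0" using h by (simp add: line)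
    then show ?thesis using d(2)[of h] h by force
  qed
qed

lemma continuous_on_dw_num: "continuous_on S (dw_num \<epsilon>)"
  unfolding dw_num_def conf_def by (intro continuous_intros)


section \<open>Stephani universes\<close>

locale stephani =
  fixes \<epsilon> :: real and I :: "real set" and R K :: "real \<Rightarrow> real" and D :: "event set"
  assumes U: "stephani_universe \<epsilon> I R K D"
begin

abbreviation of_R :: "(real \<Rightarrow> real) \<Rightarrow> real \<Rightarrow> real" where
  "of_R \<equiv> as_fun_of_R I R"

lemma open_I: "open I" and interval_I: "is_interval I"
  and smooth_R: "smooth_on I R" and smooth_K: "smooth_on I K"
  and R_pos: "t \<in> I \<Longrightarrow> R t > 0" and R'_nz: "t \<in> I \<Longrightarrow> deriv R t \<noteq> 0"
  and open_D: "open D" and fst_D: "fst ` D = I"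
  and conf_nz: "q \<in> D \<Longrightarrow> conf \<epsilon> (snd q) \<noteq> 0"
  and Kw_nz: "q \<in> D \<Longrightarrow> 1 + K (fst q) * w_coord \<epsilon> (snd q) \<noteq> 0"
  and lapse_nz: "q \<in> D \<Longrightarrow> lapse \<epsilon> I R K q \<noteq> 0"
  using U by (auto simp: stephani_universe_def stephani_domain_def)

lemma fst_in_I: "q \<in> D \<Longrightarrow> fst q \<in> I"
  using fst_D by blast

lemma of_R_R [simp]: "t \<in> I \<Longrightarrow> of_R f (R t) = f t"
  by (simp add: as_fun_of_R_def the_inv_into_f_f[OF stephani_inj_on[OF U]])

lemma continuous_R: "continuous_on I R"
  using smooth_on_DERIV[OF smooth_R] by (intro DERIV_continuous_on) (auto intro: DERIV_subset)

lemma open_RI: "open (R ` I)"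
  using injective_eq_1d_open_map_UNIV[OF continuous_R interval_I] stephani_inj_on[OF U] open_I
  by blast

lemma interval_RI: "is_interval (R ` I)"
  using connected_continuous_image[OF continuous_R] interval_I is_interval_connected_1 by blast

lemma smooth_of_R: "smooth_on I f \<Longrightarrow> smooth_on (R ` I) (of_R f)"
  unfolding as_fun_of_R_def
proof (rule smooth_on_compose_inverse[where r = R and g = "the_inv_into I R" and f = f and T = I])
  fix s assume "s \<in> R ` I"
  then obtain t where t: "t \<in> I" "s = R t" by blast
  have inv: "the_inv_into I R s = t"
    using t by (simp add: the_inv_into_f_f[OF stephani_inj_on[OF U]])
  then show "the_inv_into I R s \<in> I" using t by simp
  show "(the_inv_into I R has_real_derivative inverse (deriv R (the_inv_into I R s))) (at s)"
    unfolding inv unfolding t(2) by (rule DERIV_t_of_R[OF U t(1)])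
qed (use open_RI smooth_R R'_nz in auto)

lemma smooth_energy_density: "smooth_on I (energy_density \<epsilon> R K)"
  unfolding energy_density_def
  using R_pos less_irrefl
  by (intro smooth_on_add smooth_on_mult smooth_on_diff smooth_on_divide smooth_on_power
      smooth_on_const smooth_on_deriv smooth_R smooth_K open_I) fastforce+

lemma DERIV_comp_R:
  assumes "smooth_on (R ` I) f" "t \<in> I"
  shows "((\<lambda>t. f (R t)) has_real_derivative deriv f (R t) * deriv R t) (at t)"
  using assms DERIV_chain2[of f _ R] smooth_on_DERIV smooth_R by blast

text \<open>The times at which the line of fixed position through \<open>q\<close> meets the open
  set \<open>D\<close> form an open set, so agreement there already determines the derivative in
  t.\<close>

lemma partial_t_of_R:
  assumes f: "smooth_on (R ` I) f" and q: "q \<in> D"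
    and eq: "\<And>p. p \<in> D \<Longrightarrow> snd p = snd q \<Longrightarrow> g p = f (R (fst p))"
  shows "partial_t g q = deriv f (R (fst q)) * deriv R (fst q)"
proof -
  have "open ((\<lambda>t. (t, snd q)) -` D)"
    by (intro open_vimage open_D continuous_intros)
  then have "((\<lambda>t. g (t, snd q)) has_real_derivative deriv f (R (fst q)) * deriv R (fst q)) (at (fst q))"
    using has_field_derivative_transform_within_open[OF DERIV_comp_R[OF f fst_in_I[OF q]],
        of "(\<lambda>t. (t, snd q)) -` D" "\<lambda>t. g (t, snd q)"] eq q by simp
  then show ?thesis by (simp add: partial_t_def DERIV_imp_deriv)
qed

lemma partial_t_rho:
  "q \<in> D \<Longrightarrow> partial_t (rho \<epsilon> R K) q =
    deriv (of_R (energy_density \<epsilon> R K)) (R (fst q)) * deriv R (fst q)"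
  by (rule partial_t_of_R) (auto simp: rho_def fst_in_I intro: smooth_of_R smooth_energy_density)

end


section \<open>The indicatrix function\<close>

locale strict_stephani = stephani +
  assumes strict: "strict_nonisoenergetic_universe \<epsilon> I R K D"
begin

definition r :: "real \<Rightarrow> real" where "r = of_R (energy_density \<epsilon> R K)"
definition k :: "real \<Rightarrow> real" where "k = of_R K"

abbreviation a :: "real \<Rightarrow> real" where "a \<equiv> a_fun r"

definition k_ratio :: "real \<Rightarrow> real" where
  "k_ratio s = deriv (deriv k) s / deriv k s"

text \<open>With \<open>y = 1/N\<close> one has \<open>\<pi> = -1 + a y\<close> and \<open>\<chi> = -2/3 + B (\<pi> + 1) - A (\<pi> + 1)\<^sup>2\<close>.\<close>

definition A :: "real \<Rightarrow> real" where
  "A s = s * k_ratio s / (3 * (a s)\<^sup>2)"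

definition B :: "real \<Rightarrow> real" where
  "B s = (a s - s * deriv a s / (3 * a s) - 1 / 3 + s * k_ratio s / 3) / a s"

text \<open>The lapse with R and w as independent variables, so that its partial derivatives become
  ordinary ones.\<close>

definition N :: "real \<Rightarrow> real \<Rightarrow> real" where
  "N s w = 1 - s * deriv k s * w / (1 + k s * w)"

lemma s_nz: "s \<in> R ` I \<Longrightarrow> s \<noteq> 0"
  using R_pos by fastforce

lemma smooth_r: "smooth_on (R ` I) r" and smooth_k: "smooth_on (R ` I) k"
  unfolding r_def k_def by (intro smooth_of_R smooth_energy_density smooth_K)+

lemma k'_nz: "s \<in> R ` I \<Longrightarrow> deriv k s \<noteq> 0"
  using strict by (auto simp: strict_nonisoenergetic_universe_def k_def)

text \<open>The time interval \<open>I\<close> is exactly the range of t on \<open>D\<close>, so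
  every \<open>s\<close> lies under a point of \<open>D\<close>, where the hypothesis on \<rho>
  applies.\<close>

lemma r_nz: "s \<in> R ` I \<Longrightarrow> r s \<noteq> 0"
proof -
  assume "s \<in> R ` I"
  then obtain q where q: "q \<in> D" "s = R (fst q)" using fst_D by blast
  then have "rho \<epsilon> R K q \<noteq> 0"
    using strict by (simp add: strict_nonisoenergetic_universe_def)
  then show ?thesis using q fst_in_I by (simp add: rho_def r_def)
qed

lemma r'_nz:
  assumes "s \<in> R ` I"
  shows "deriv r s \<noteq> 0"
proof -
  obtain q where q: "q \<in> D" "s = R (fst q)" using assms fst_D by blast
  then have "udot \<epsilon> I R K (rho \<epsilon> R K) q \<noteq> 0"
    using strict by (simp add: strict_nonisoenergetic_universe_def)
  then show ?thesis using q by (simp add: udot_def partial_t_rho r_def)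
qed

lemma a_nz: "s \<in> R ` I \<Longrightarrow> a s \<noteq> 0"
  by (simp add: a_fun_def r_nz r'_nz s_nz)

lemma smooth_a: "smooth_on (R ` I) a"
  unfolding a_fun_def
  by (intro smooth_on_minus smooth_on_divide smooth_on_mult smooth_on_const smooth_on_ident
      smooth_on_deriv smooth_r open_RI) (simp add: r_nz)

lemma smooth_k_ratio: "smooth_on (R ` I) k_ratio"
  unfolding k_ratio_def
  by (intro smooth_on_divide smooth_on_deriv smooth_k open_RI k'_nz)

lemma smooth_A: "smooth_on (R ` I) A"
  unfolding A_def
  by (intro smooth_on_divide smooth_on_mult smooth_on_const smooth_on_ident smooth_on_power
      smooth_a smooth_k_ratio open_RI) (simp add: a_nz)

lemma smooth_B: "smooth_on (R ` I) B"
  unfolding B_def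
  by (intro smooth_on_divide smooth_on_mult smooth_on_const smooth_on_ident smooth_on_add
      smooth_on_diff smooth_on_deriv smooth_a smooth_k_ratio open_RI) (simp_all add: a_nz)

section \<open>Derivatives of the coefficients \<open>A\<close> and \<open>B\<close>, and the two
  differential equations\<close>

lemmas DERIV_k' = smooth_on_DERIV[OF smooth_on_deriv[OF smooth_k]]
lemmas DERIV_k'' = smooth_on_DERIV[OF smooth_on_deriv[OF smooth_on_deriv[OF smooth_k]]]
lemmas DERIV_a = smooth_on_DERIV[OF smooth_a]
lemmas DERIV_a' = smooth_on_DERIV[OF smooth_on_deriv[OF smooth_a]]

text \<open>The quotient rule for \<open>A\<close> as an identity between independent reals:
  \<open>a1\<close> stands for a', and \<open>k1\<close>, \<open>k2\<close>, \<open>k3\<close> for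
  K', K'', K'''. The last factor on the right is the defect of the second differential
  equation.\<close>

lemma deriv_A_algebra:
  fixes s a a1 k1 k2 k3 :: real
  assumes nz: "s \<noteq> 0" "a \<noteq> 0" "k1 \<noteq> 0"
  shows "((s * ((k3 * k1 - k2 * k2) / (k1 * k1)) + k2 / k1) * (3 * a\<^sup>2) - (s * (k2 / k1)) * (6 * a * a1)) / ((3 * a\<^sup>2) * (3 * a\<^sup>2))
    = s / (3 * k1 * a\<^sup>2) * (k3 - k2 * (k2 / k1 - 1 / s) - 2 * k2 * (a1 / a))"
  using nz by (simp add: divide_simps) (simp add: algebra_simps power2_eq_square power4_eq_xxxx)
lemma deriv_A:
  assumes s: "s \<in> R ` I"
  shows "deriv A s = s / (3 * deriv k s * (a s)\<^sup>2) *
    (deriv (deriv (deriv k)) s - deriv (deriv k) s * (k_ratio s - 1 / s)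
       - 2 * deriv (deriv k) s * (deriv a s / a s))"
proof (rule DERIV_imp_deriv)
  have "(k_ratio has_real_derivative (deriv (deriv (deriv k)) s * deriv k s
      - deriv (deriv k) s * deriv (deriv k) s) / (deriv k s * deriv k s)) (at s)"
    unfolding k_ratio_def using DERIV_divide[OF DERIV_k''[OF s] DERIV_k'[OF s] k'_nz[OF s]] .
  then have "((\<lambda>s. s * k_ratio s) has_real_derivative s * ((deriv (deriv (deriv k)) s * deriv k s
      - deriv (deriv k) s * deriv (deriv k) s) / (deriv k s * deriv k s)) + k_ratio s) (at s)"
    by (auto intro!: derivative_eq_intros)
  moreover have "((\<lambda>s. 3 * (a s)\<^sup>2) has_real_derivative 6 * a s * deriv a s) (at s)"
    by (auto intro!: derivative_eq_intros DERIV_a[OF s])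
  ultimately show "(A has_real_derivative s / (3 * deriv k s * (a s)\<^sup>2) *
    (deriv (deriv (deriv k)) s - deriv (deriv k) s * (k_ratio s - 1 / s)
       - 2 * deriv (deriv k) s * (deriv a s / a s))) (at s)"
    unfolding A_def
    using a_nz[OF s] deriv_A_algebra[OF s_nz[OF s] a_nz[OF s] k'_nz[OF s], of _ _ "deriv a s"]
    by (intro DERIV_cong[OF DERIV_divide]) (simp_all only: k_ratio_def mult.assoc, simp)
qed

text \<open>The last bracket is the defect of the first differential equation; K''' enters through
  \<open>deriv A\<close> alone.\<close>

lemma deriv_B:
  assumes s: "s \<in> R ` I"
  shows "deriv B s = a s * deriv A s
     - s / (3 * (a s)\<^sup>2) * (deriv (deriv a) s - 2 * (deriv a s)\<^sup>2 / a s - deriv a s * k_ratio s)"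
proof (rule DERIV_imp_deriv)
  \<comment> \<open>Writing the \<open>k_ratio\<close> term of \<open>B\<close> as
    \<open>a x * A x\<close> keeps K''' inside the derivative of \<open>A\<close>.\<close>
  have B: "1 - x * deriv a x / (3 * (a x)\<^sup>2) - 1 / (3 * a x) + a x * A x = B x" if "x \<in> R ` I" for x
    unfolding A_def B_def using a_nz[OF that] by (simp add: field_simps power2_eq_square)
  have "((\<lambda>s. 1 - s * deriv a s / (3 * (a s)\<^sup>2) - 1 / (3 * a s) + a s * A s) has_real_derivative
      a s * deriv A s + deriv a s * A s - (s * deriv (deriv a) s / (3 * (a s)\<^sup>2) - 2 * s * (deriv a s)\<^sup>2 / (3 * a s ^ 3))) (at s)"
    using a_nz[OF s]
    by (auto intro!: derivative_eq_intros DERIV_a[OF s] DERIV_a'[OF s]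
        smooth_on_DERIV[OF smooth_A s])
      (simp add: field_simps power2_eq_square power3_eq_cube power4_eq_xxxx)
  also have "a s * deriv A s + deriv a s * A s
      - (s * deriv (deriv a) s / (3 * (a s)\<^sup>2) - 2 * s * (deriv a s)\<^sup>2 / (3 * a s ^ 3)) =
    a s * deriv A s
     - s / (3 * (a s)\<^sup>2) * (deriv (deriv a) s - 2 * (deriv a s)\<^sup>2 / a s - deriv a s * k_ratio s)"
    unfolding A_def[of s] using a_nz[OF s]
    by (simp add: field_simps power2_eq_square power3_eq_cube)
  finally show "(B has_real_derivative a s * deriv A s
     - s / (3 * (a s)\<^sup>2) * (deriv (deriv a) s - 2 * (deriv a s)\<^sup>2 / a s - deriv a s * k_ratio s)) (at s)"
    by (rule has_field_derivative_transform_within_open[OF _ open_RI s B])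
qed

text \<open>The system is triangular: A' is a non-zero multiple of the second defect, and B' - a A'
  is a non-zero multiple of the first.\<close>

lemma ideal_gas_equations_iff:
  "ideal_gas_equations (R ` I) r k \<longleftrightarrow> (\<forall>s\<in>R ` I. deriv A s = 0 \<and> deriv B s = 0)"
  unfolding ideal_gas_equations_def Let_def k_ratio_def[symmetric]
proof (intro ball_cong refl)
  fix s assume s: "s \<in> R ` I"
  have "(E1 = f \<and> k3 - e = g) = (A' = 0 \<and> B' = 0)"
    if "A' = x * (k3 - e - g)" "B' = a s * A' - y * (E1 - f)" "x \<noteq> 0" "y \<noteq> 0"
    for E1 f k3 e g A' B' x y :: real
    using that by auto
  from this[OF deriv_A[OF s] deriv_B[OF s]]
  show "(deriv (deriv a) s - 2 * (deriv a s)\<^sup>2 / a s = deriv a s * k_ratio s \<and>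
      deriv (deriv (deriv k)) s - deriv (deriv k) s * (k_ratio s - 1 / s) =
        2 * deriv (deriv k) s * (deriv a s / a s)) = (deriv A s = 0 \<and> deriv B s = 0)"
    using s_nz[OF s] a_nz[OF s] k'_nz[OF s] by simp
qed

section \<open>Pressure, \<pi> and \<chi> as functions of R and w\<close>

lemma lapse_N: "q \<in> D \<Longrightarrow> lapse \<epsilon> I R K q = N (R (fst q)) (w_coord \<epsilon> (snd q))"
  using lapse_eq[OF U] by (simp add: N_def k_def fst_in_I)

lemma N_nz: "q \<in> D \<Longrightarrow> N (R (fst q)) (w_coord \<epsilon> (snd q)) \<noteq> 0"
  using lapse_N lapse_nz by simp

lemma kw_nz: "q \<in> D \<Longrightarrow> 1 + k (R (fst q)) * w_coord \<epsilon> (snd q) \<noteq> 0"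
  using Kw_nz fst_in_I by (simp add: k_def)

text \<open>By the definition of \<open>a\<close>, the product - (s / 3) \<rho>' equals a
  \<rho>.\<close>

lemma pressure_eq:
  assumes q: "q \<in> D"
  defines "s \<equiv> R (fst q)"
  shows "pressure \<epsilon> I R K q = r s * (-1 + a s / N s (w_coord \<epsilon> (snd q)))"
proof -
  have "partial_R I R (rho \<epsilon> R K) q = deriv r s"
    by (simp add: partial_R_def rho_def r_def s_def)
  moreover have "rho \<epsilon> R K q = r s"
    using fst_in_I[OF q] by (simp add: rho_def r_def s_def)
  ultimately show ?thesis
    using r_nz fst_in_I[OF q] N_nz[OF q]
    by (simp add: pressure_def lapse_N[OF q] a_fun_def s_def field_simps)
qed

lemma pi_eq:
  assumes q: "q \<in> D"
  shows "pi_fun \<epsilon> I R K q = -1 + a (R (fst q)) / N (R (fst q)) (w_coord \<epsilon> (snd q))"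
proof -
  have "rho \<epsilon> R K q = r (R (fst q))"
    using fst_in_I[OF q] by (simp add: rho_def r_def)
  then show ?thesis
    using r_nz fst_in_I[OF q] by (simp add: pi_fun_def pressure_eq[OF q])
qed

text \<open>Here \<open>n1\<close> is the derivative of N in R at fixed w. Eliminating w turns both
  sides into the same quadratic polynomial in 1/N.\<close>

lemma chi_algebra:
  fixes s a a1 k0 k1 k2 w :: real
  assumes nz: "s \<noteq> 0" "a \<noteq> 0" "k1 \<noteq> 0" "1 + k0 * w \<noteq> 0"
    and n: "n = 1 - s * k1 * w / (1 + k0 * w)" "n \<noteq> 0"
    and n1: "n1 = - (((k1 * w + s * k2 * w) * (1 + k0 * w) - s * k1 * w * (k1 * w)) /
      ((1 + k0 * w) * (1 + k0 * w)))"
  shows "-1 + a / n - s / (3 * a) * (a1 / n - a * n1 / n\<^sup>2) =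
    - 2 / 3 + (a - s * a1 / (3 * a) - 1 / 3 + s * (k2 / k1) / 3) / a * (a / n)
      - s * (k2 / k1) / (3 * a\<^sup>2) * (a / n)\<^sup>2"
proof -
  \<comment> \<open>In terms of \<open>v\<close> the lapse is affine and its derivative quadratic;
    \<open>k1 * v = (1 - n) / s\<close> then removes w altogether.\<close>
  define v where "v = w / (1 + k0 * w)"
  define h where "h = k2 / k1"
  have k2: "k2 = h * k1" using nz by (simp add: h_def)
  have v: "n = 1 - s * k1 * v" "n1 = - (k1 * v + s * k2 * v - s * (k1 * v)\<^sup>2)"
    unfolding n n1 v_def using nz(4)
    by (simp_all add: power2_eq_square add_divide_distrib diff_divide_distrib)
  have kv: "k1 * v = (1 - n) / s"
    using v(1) nz by (simp add: field_simps)
  have "n1 = - (k1 * v + s * h * (k1 * v) - s * (k1 * v)\<^sup>2)"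
    unfolding v(2) k2 by simp
  also have "\<dots> = - ((1 - n) / s) * n - h * (1 - n)"
    unfolding kv using nz(1) by (simp add: field_simps power2_eq_square)
  finally have n1: "n1 = - ((1 - n) / s) * n - h * (1 - n)" .
  define y where "y = inverse n"
  have y: "1 / n = y" "n * y = 1" "a / n = a * y" "n1 / n\<^sup>2 = n1 * y * y" "a1 / n = a1 * y" "a * n1 / n\<^sup>2 = a * n1 * y * y"
    using n(2) by (simp_all add: y_def field_simps power2_eq_square)
  \<comment> \<open>Every spare factor \<open>n\<close> is absorbed by \<open>n * y = 1\<close>,
    which leaves a polynomial in \<open>y\<close>.\<close>
  have "n1 * y * y = - ((y - 1) / s)  - h * (y * y - y)"
  proof -
    have "n1 * y * y = - (y - n * y) / s * (n * y) - h * (y * y - (n * y) * y)"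
      unfolding n1 using nz by (simp add: field_simps)
    then show ?thesis unfolding y(2) using nz by (simp add: field_simps)
  qed
  then have e: "a * n1 * y * y = a * (- ((y - 1) / s)  - h * (y * y - y))"
    by (simp add: mult.assoc)
  show ?thesis unfolding y unfolding h_def[symmetric] e
    using nz(1,2) by (simp add: field_simps power2_eq_square)
qed

text \<open>The factors 1/N and dR/dt cancel in \<chi>, so \<chi> is the R-derivative of p at fixed
  w divided by \<rho>'. With p = \<rho> (-1 + a/N), what remains is the derivative of a/N.\<close>

lemma chi_eq:
  assumes q: "q \<in> D"
  defines "s \<equiv> R (fst q)" and "y \<equiv> pi_fun \<epsilon> I R K q + 1"
  shows "chi_fun \<epsilon> I R K q = - 2 / 3 + B s * y - A s * y\<^sup>2"
proof -
  define w where "w = w_coord \<epsilon> (snd q)"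
  have s: "s \<in> R ` I" using fst_in_I[OF q] by (simp add: s_def)
  note nz = s_nz[OF s] a_nz[OF s] k'_nz[OF s] r_nz[OF s] r'_nz[OF s]
  have nz': "N s w \<noteq> 0" "1 + k s * w \<noteq> 0"
    using N_nz[OF q] kw_nz[OF q] by (simp_all add: s_def w_def)
  define n1 where "n1 = - (((deriv k s * w + s * deriv (deriv k) s * w) * (1 + k s * w)
    - s * deriv k s * w * (deriv k s * w)) / ((1 + k s * w) * (1 + k s * w)))"
  have d1: "((\<lambda>s. s * deriv k s * w) has_real_derivative deriv k s * w + s * deriv (deriv k) s * w) (at s)"
    by (auto intro!: derivative_eq_intros DERIV_k'[OF s] simp: algebra_simps)
  have d2: "((\<lambda>s. 1 + k s * w) has_real_derivative deriv k s * w) (at s)"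
    by (auto intro!: derivative_eq_intros smooth_on_DERIV[OF smooth_k s])
  have dN: "((\<lambda>s. N s w) has_real_derivative n1) (at s)"
    unfolding N_def n1_def
    using DERIV_diff[OF DERIV_const[of 1] DERIV_divide[OF d1 d2 nz'(2)]] by simp
  define y' where "y' = (deriv a s * N s w - a s * n1) / (N s w * N s w)"
  define p1 where "p1 = deriv r s * (-1 + a s / N s w) + y' * r s"
  have "((\<lambda>s. -1 + a s / N s w) has_real_derivative y') (at s)"
    unfolding y'_def
    using DERIV_add[OF DERIV_const DERIV_divide[OF DERIV_a[OF s] dN nz'(1)], of "-1"] by simp
  then have dp: "((\<lambda>s. r s * (-1 + a s / N s w)) has_real_derivative p1) (at s)"
    unfolding p1_def by (rule DERIV_mult[OF smooth_on_DERIV[OF smooth_r s]])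
  have "((\<lambda>t. r (R t) * (-1 + a (R t) / N (R t) w)) has_real_derivative
          p1 * deriv R (fst q)) (at (fst q))"
    using DERIV_chain2[OF dp[unfolded s_def] smooth_on_DERIV[OF smooth_R fst_in_I[OF q]]] .
  moreover have "open ((\<lambda>t. (t, snd q)) -` D)"
    by (intro open_vimage open_D continuous_intros)
  ultimately have "((\<lambda>t. pressure \<epsilon> I R K (t, snd q)) has_real_derivative
      p1 * deriv R (fst q)) (at (fst q))"
    by (rule has_field_derivative_transform_within_open)
      (use q in \<open>auto simp: pressure_eq w_def\<close>)
  then have "partial_t (pressure \<epsilon> I R K) q = p1 * deriv R (fst q)"
    by (simp add: partial_t_def DERIV_imp_deriv)
  then have "chi_fun \<epsilon> I R K q = p1 / deriv r s"
    using lapse_nz[OF q] R'_nz[OF fst_in_I[OF q]]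
    by (simp add: chi_fun_def udot_def partial_t_rho[OF q] r_def s_def)
  also have "p1 / deriv r s = -1 + a s / N s w - s / (3 * a s) * y'"
  proof -
    \<comment> \<open>This is the definition of \<open>a\<close> solved for \<rho> /
      \<rho>'.\<close>
    have "r s / deriv r s = - (s / (3 * a s))"
      unfolding a_fun_def using nz by simp
    moreover have "p1 / deriv r s = -1 + a s / N s w + y' * (r s / deriv r s)"
      unfolding p1_def using nz(5) by (simp add: add_divide_distrib)
    ultimately show ?thesis by (simp only:) (simp add: mult.commute)
  qed
  also have "y' = deriv a s / N s w - a s * n1 / (N s w)\<^sup>2"
    unfolding y'_def using nz' by (simp add: diff_divide_distrib power2_eq_square)
  also have "-1 + a s / N s w - s / (3 * a s) * (deriv a s / N s w - a s * n1 / (N s w)\<^sup>2) =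
      - 2 / 3 + B s * (a s / N s w) - A s * (a s / N s w)\<^sup>2"
    unfolding A_def B_def k_ratio_def
    by (rule chi_algebra) (use nz nz' in \<open>auto simp: n1_def N_def\<close>)
  also have "a s / N s w = y"
    by (simp add: y_def pi_eq[OF q] s_def w_def)
  finally show ?thesis .
qed

end


section \<open>The ideal gas condition\<close>

context strict_stephani
begin

text \<open>\<open>frechet_derivative\<close> is informative only where the function is
  differentiable. On the open set \<open>D\<close> the formula of \<open>pi_eq\<close> is a quotient
  of differentiable functions with non-zero denominator.\<close>

lemma pi_differentiable:
  assumes q: "q \<in> D"
  shows "pi_fun \<epsilon> I R K differentiable (at q)"
proof -
  have lift: "(\<lambda>p::event. f (R (fst p))) differentiable (at q)" if "smooth_on (R ` I) f" for f
  proof -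
    have "(\<lambda>t. f (R t)) differentiable at (fst q)"
      using DERIV_comp_R[OF that fst_in_I[OF q]] real_differentiable_def by blast
    moreover have "fst differentiable (at q)"
      by (rule bounded_linear_imp_differentiable[OF bounded_linear_fst])
    ultimately show ?thesis
      using differentiable_chain_at[of fst q "\<lambda>t. f (R t)"] by (simp add: o_def)
  qed
  have comp: "(\<lambda>p::event. snd p $ 3) differentiable (at q)"
    by (intro bounded_linear_imp_differentiable bounded_linear_compose[OF bounded_linear_vec_nth bounded_linear_snd])
  have "(\<lambda>p::event. (norm (snd p))\<^sup>2) differentiable (at q)"
    unfolding power2_norm_eq_inner
    by (intro differentiable_inner bounded_linear_imp_differentiable[OF bounded_linear_snd])
  then have "(\<lambda>p::event. conf \<epsilon> (snd p)) differentiable (at q)"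
    unfolding conf_def by (intro differentiable_add differentiable_mult differentiable_const)
  then have w: "(\<lambda>p::event. w_coord \<epsilon> (snd p)) differentiable (at q)"
    unfolding w_coord_def by (intro differentiable_divide comp conf_nz[OF q])
  have "(\<lambda>p. N (R (fst p)) (w_coord \<epsilon> (snd p))) differentiable (at q)"
    unfolding N_def
    by (intro differentiable_diff differentiable_divide differentiable_mult differentiable_add
        differentiable_const w lift smooth_k smooth_on_deriv smooth_on_ident kw_nz[OF q])
  then have "(\<lambda>p. -1 + a (R (fst p)) / N (R (fst p)) (w_coord \<epsilon> (snd p))) differentiable (at q)"
    by (intro differentiable_divide differentiable_add differentiable_const lift smooth_a N_nz[OF q])
  then show ?thesis
    unfolding differentiable_def
    by (blast intro: has_derivative_transform_within_open[OF _ open_D q] pi_eq[symmetric])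
qed

text \<open>Since \<open>\<chi> = F(R, \<pi>)\<close>, only the partial derivative of \<open>F\<close> in \<open>R\<close> contributes to \<open>d\<chi> \<and> d\<pi>\<close>.\<close>

lemma wedge_chi_pi:
  assumes q: "q \<in> D"
  defines "s \<equiv> R (fst q)" and "y \<equiv> pi_fun \<epsilon> I R K q + 1"
    and "P \<equiv> frechet_derivative (pi_fun \<epsilon> I R K) (at q)"
  shows "wedge (frechet_derivative (chi_fun \<epsilon> I R K) (at q)) P X Y =
    (deriv B s * y - deriv A s * y\<^sup>2) * deriv R (fst q) * (fst X * P Y - fst Y * P X)"
proof -
  have P: "(pi_fun \<epsilon> I R K has_derivative P) (at q)"
    unfolding P_def using pi_differentiable[OF q] frechet_derivative_works by blast
  have lift: "((\<lambda>p::event. f (R (fst p))) has_derivative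
      (\<lambda>X. deriv f s * deriv R (fst q) * fst X)) (at q)" if "smooth_on (R ` I) f" for f
    using has_derivative_compose[OF has_derivative_fst[OF has_derivative_ident]
        DERIV_comp_R[OF that fst_in_I[OF q], unfolded has_field_derivative_def]]
    by (simp add: s_def)
  have "((\<lambda>p. - 2 / 3 + B (R (fst p)) * (pi_fun \<epsilon> I R K p + 1)
        - A (R (fst p)) * (pi_fun \<epsilon> I R K p + 1)\<^sup>2) has_derivative
      (\<lambda>X. (deriv B s * y - deriv A s * y\<^sup>2) * deriv R (fst q) * fst X +
           (B s - 2 * A s * y) * P X)) (at q)"
    by (rule has_derivative_eq_rhs)
      (auto intro!: derivative_eq_intros lift[OF smooth_A] lift[OF smooth_B] P
        simp: s_def[symmetric] y_def algebra_simps power2_eq_square)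
  then have "(chi_fun \<epsilon> I R K has_derivative
      (\<lambda>X. (deriv B s * y - deriv A s * y\<^sup>2) * deriv R (fst q) * fst X +
           (B s - 2 * A s * y) * P X)) (at q)"
    by (rule has_derivative_transform_within_open[OF _ open_D q]) (simp add: chi_eq)
  from frechet_derivative_at[OF this, symmetric] show ?thesis
    by (simp add: wedge_def algebra_simps)
qed

text \<open>Chain rule through w: dN/dw = - s K' / (1 + K w)^2 is non-zero because K' is, and dw/dz
  is non-zero because \<open>dw_num\<close> is.\<close>

lemma DERIV_pi_line:
  assumes q: "(t, x) \<in> D" and w: "dw_num \<epsilon> x \<noteq> 0"
  shows "\<exists>d. d \<noteq> 0 \<and>
    ((\<lambda>h. pi_fun \<epsilon> I R K (t, x + h *\<^sub>R axis 3 1)) has_real_derivative d) (at 0)"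
proof -
  define s where "s = R t"
  define w0 where "w0 = w_coord \<epsilon> x"
  have s: "s \<in> R ` I" using fst_in_I[OF q] by (simp add: s_def)
  have nz: "1 + k s * w0 \<noteq> 0" "N s w0 \<noteq> 0" "conf \<epsilon> x \<noteq> 0"
    using kw_nz[OF q] N_nz[OF q] conf_nz[OF q] by (simp_all add: s_def w0_def)
  define n1 where "n1 = - (s * deriv k s / (1 + k s * w0)\<^sup>2)"
  have n1: "n1 \<noteq> 0" using s_nz[OF s] k'_nz[OF s] nz by (simp add: n1_def)
  have "(N s has_real_derivative n1) (at w0)"
    unfolding N_def n1_def using nz(1)
    by (auto intro!: derivative_eq_intros simp: field_simps power2_eq_square)
  then have "((\<lambda>w. -1 + a s / N s w) has_real_derivative - (a s * n1 / (N s w0)\<^sup>2)) (at w0)"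
    using nz(2) by (auto intro!: derivative_eq_intros simp: power2_eq_square)
  then have "((\<lambda>h. -1 + a s / N s (w_coord \<epsilon> (x + h *\<^sub>R axis 3 1))) has_real_derivative
      - (a s * n1 / (N s w0)\<^sup>2) * (dw_num \<epsilon> x / (conf \<epsilon> x)\<^sup>2)) (at 0)"
    by (intro DERIV_chain2[OF _ DERIV_w_coord_line[OF nz(3)]]) (simp add: w0_def)
  moreover have "open ((\<lambda>h::real. (t, x + h *\<^sub>R axis 3 1)) -` D)"
    by (intro open_vimage open_D continuous_intros)
  ultimately have "((\<lambda>h. pi_fun \<epsilon> I R K (t, x + h *\<^sub>R axis 3 1)) has_real_derivative
      - (a s * n1 / (N s w0)\<^sup>2) * (dw_num \<epsilon> x / (conf \<epsilon> x)\<^sup>2)) (at 0)"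
    by (rule has_field_derivative_transform_within_open) (use q in \<open>auto simp: pi_eq s_def\<close>)
  then show ?thesis
    using a_nz[OF s] n1 nz w by (intro exI conjI) auto
qed

lemma ideal_gas_condition_pointwise:
  assumes "ideal_gas_condition \<epsilon> I R K D" and q: "(t, x) \<in> D" and w: "dw_num \<epsilon> x \<noteq> 0"
  shows "deriv B (R t) = deriv A (R t) * (pi_fun \<epsilon> I R K (t, x) + 1)"
proof -
  define P where "P = frechet_derivative (pi_fun \<epsilon> I R K) (at (t, x))"
  define y where "y = pi_fun \<epsilon> I R K (t, x) + 1"
  obtain d where d: "d \<noteq> 0"
    "((\<lambda>h. pi_fun \<epsilon> I R K (t, x + h *\<^sub>R axis 3 1)) has_real_derivative d) (at 0)"
    using DERIV_pi_line[OF q w] by blast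
  have "(pi_fun \<epsilon> I R K has_derivative P) (at (t, x + 0 *\<^sub>R axis 3 1))"
    using pi_differentiable[OF q] frechet_derivative_works by (auto simp: P_def)
  moreover have "((\<lambda>h::real. (t, x + h *\<^sub>R axis 3 1)) has_derivative (\<lambda>h. (0, h *\<^sub>R axis 3 1))) (at 0)"
    by (auto intro!: derivative_eq_intros)
  ultimately have "((\<lambda>h. pi_fun \<epsilon> I R K (t, x + h *\<^sub>R axis 3 1)) has_derivative
      (\<lambda>h. P (0, h *\<^sub>R axis 3 1))) (at 0)"
    by (rule has_derivative_compose[rotated])
  from has_derivative_unique[OF this d(2)[unfolded has_field_derivative_def]]
  have "P (0, axis 3 1) = d" by (metis mult.right_neutral scaleR_one)
  \<comment> \<open>On this pair of directions, t and z, the factor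
    \<open>fst X * P Y - fst Y * P X\<close> reduces to \<open>P (0, axis 3 1)\<close>, that is, to
    the non-zero number \<open>d\<close>.\<close>
  moreover have "wedge (frechet_derivative (chi_fun \<epsilon> I R K) (at (t, x))) P (1, 0) (0, axis 3 1) = 0"
    using assms(1) q unfolding ideal_gas_condition_def P_def by blast
  ultimately have "(deriv B (R t) * y - deriv A (R t) * y\<^sup>2) * deriv R t * d = 0"
    unfolding P_def wedge_chi_pi[OF q] by (simp add: y_def)
  then have "deriv B (R t) * y = deriv A (R t) * y * y"
    using d(1) R'_nz fst_in_I[OF q] by (simp add: power2_eq_square)
  moreover have "y \<noteq> 0"
    using a_nz N_nz[OF q] fst_in_I[OF q] by (simp add: y_def pi_eq[OF q])
  ultimately show ?thesis by (simp add: y_def)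
qed

text \<open>From left to right, B' = A' (\<pi> + 1) holds at fixed R on an open set of positions.
  Differentiating along z, where \<pi> has non-zero derivative, gives A' = 0 and then B' =
  0.\<close>

lemma ideal_gas_condition_iff:
  "ideal_gas_condition \<epsilon> I R K D \<longleftrightarrow> (\<forall>s\<in>R ` I. deriv A s = 0 \<and> deriv B s = 0)"
proof
  assume "\<forall>s\<in>R ` I. deriv A s = 0 \<and> deriv B s = 0"
  then show "ideal_gas_condition \<epsilon> I R K D"
    unfolding ideal_gas_condition_def by (simp add: wedge_chi_pi fst_in_I)
next
  assume cond: "ideal_gas_condition \<epsilon> I R K D"
  show "\<forall>s\<in>R ` I. deriv A s = 0 \<and> deriv B s = 0"
  proof
    fix s assume "s \<in> R ` I"
    then obtain t x0 where t: "s = R t" "(t, x0) \<in> D" using fst_D by fastforce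
    define S where "S = (\<lambda>x. (t, x)) -` D"
    have S: "open S" unfolding S_def by (intro open_vimage open_D continuous_intros)
    obtain x where x: "x \<in> S" "dw_num \<epsilon> x \<noteq> 0"
      using exists_dw_num_nonzero[OF S] t(2) by (auto simp: S_def)
    \<comment> \<open>Openness of \<open>V\<close> makes the pointwise identity valid for all small
      \<open>h\<close>, as its differentiation at \<open>h = 0\<close> demands.\<close>
    define V where "V = S \<inter> dw_num \<epsilon> -` (- {0})"
    have V: "open V" unfolding V_def
      by (intro continuous_open_preimage continuous_on_dw_num S) auto
    obtain d where d: "d \<noteq> 0"
      "((\<lambda>h. pi_fun \<epsilon> I R K (t, x + h *\<^sub>R axis 3 1)) has_real_derivative d) (at 0)"
      using DERIV_pi_line x by (auto simp: S_def)
    have "((\<lambda>h. deriv A s * (pi_fun \<epsilon> I R K (t, x + h *\<^sub>R axis 3 1) + 1)) has_real_derivative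
        deriv A s * d) (at 0)"
      by (auto intro!: derivative_eq_intros d(2))
    moreover have "open ((\<lambda>h::real. x + h *\<^sub>R axis 3 1) -` V)"
      by (intro open_vimage V continuous_intros)
    moreover have "0 \<in> (\<lambda>h::real. x + h *\<^sub>R axis 3 1) -` V"
      using x by (simp add: V_def)
    ultimately have "((\<lambda>h. deriv B s) has_real_derivative deriv A s * d) (at 0)"
    proof (rule has_field_derivative_transform_within_open)
      fix h :: real assume "h \<in> (\<lambda>h. x + h *\<^sub>R axis 3 1) -` V"
      then show "deriv A s * (pi_fun \<epsilon> I R K (t, x + h *\<^sub>R axis 3 1) + 1) = deriv B s"
        using ideal_gas_condition_pointwise[OF cond, of t "x + h *\<^sub>R axis 3 1"]
        by (simp add: V_def S_def t(1))
    qed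
    then have "deriv A s * d = 0"
      by (rule DERIV_unique[OF _ DERIV_const])
    then have "deriv A s = 0" using d(1) by simp
    moreover have "deriv B s = deriv A s * (pi_fun \<epsilon> I R K (t, x) + 1)"
      using ideal_gas_condition_pointwise[OF cond] x by (auto simp: S_def t)
    ultimately show "deriv A s = 0 \<and> deriv B s = 0" by simp
  qed
qed

text \<open>\<open>A\<close> and \<open>B\<close> are constant on the interval R(I). The relation
  between the coefficients says that the quadratic takes the value -2/3 at \<pi> = -1, which is
  visible in \<open>chi_eq\<close>.\<close>

lemma chi_quadratic:
  assumes "ideal_gas_condition \<epsilon> I R K D"
  shows "\<exists>\<alpha> \<beta> \<gamma> :: real. \<alpha> + \<beta> = \<gamma> - 2 / 3 \<and>
           (\<forall>q\<in>D. chi_fun \<epsilon> I R K q =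
                    \<alpha> * (pi_fun \<epsilon> I R K q)\<^sup>2 + \<gamma> * pi_fun \<epsilon> I R K q + \<beta>)"
proof -
  have "\<exists>c. \<forall>s\<in>R ` I. f s = c"
    if f: "smooth_on (R ` I) f" "\<forall>s\<in>R ` I. deriv f s = 0" for f
  proof -
    have "convex (R ` I)" using interval_RI is_interval_convex by blast
    moreover have "(f has_field_derivative 0) (at s within R ` I)" if "s \<in> R ` I" for s
      using has_field_derivative_at_within[OF smooth_on_DERIV[OF f(1) that]] f(2) that by simp
    ultimately obtain c where "\<And>s. s \<in> R ` I \<Longrightarrow> f s = c"
      using has_field_derivative_zero_constant[of "R ` I" f] by blast
    then show ?thesis by blast
  qed
  from this[OF smooth_A] this[OF smooth_B]
  obtain A0 B0 where "\<forall>s\<in>R ` I. A s = A0" "\<forall>s\<in>R ` I. B s = B0"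
    using assms[unfolded ideal_gas_condition_iff] by blast
  then have "chi_fun \<epsilon> I R K q = - A0 * (pi_fun \<epsilon> I R K q)\<^sup>2 + (B0 - 2 * A0) * pi_fun \<epsilon> I R K q
      + (B0 - A0 - 2 / 3)" if "q \<in> D" for q
    using that fst_in_I by (simp add: chi_eq power2_eq_square algebra_simps)
  then show ?thesis
    by (intro exI[of _ "- A0"] exI[of _ "B0 - A0 - 2 / 3"] exI[of _ "B0 - 2 * A0"]) simp
qed

section \<open>Correspondence between universes and solutions of the equations\<close>

text \<open>The witnesses are R(I), \<open>r\<close> and \<open>k\<close>; the generalized Friedmann
  equation is then the definition of the energy density.\<close>

lemma obtained_from_solution_if_equations:
  assumes "ideal_gas_equations (R ` I) r k"
  shows "obtained_from_solution \<epsilon> I R K D"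
proof -
  have "\<forall>t\<in>I. deriv R t \<noteq> 0 \<and> r (R t) =
      3 / (R t)\<^sup>2 * (deriv R t)\<^sup>2 + 3 / (R t)\<^sup>2 * (\<epsilon> - (k (R t))\<^sup>2) \<and> K t = k (R t)"
    using R'_nz by (simp add: r_def k_def energy_density_def)
  moreover have "R ` I \<subseteq> {0<..}" using R_pos by auto
  moreover have "\<forall>s\<in>R ` I. r s \<noteq> 0 \<and> deriv r s \<noteq> 0 \<and> deriv k s \<noteq> 0"
    using r_nz r'_nz k'_nz by blast
  ultimately show ?thesis
    unfolding obtained_from_solution_def
    using U open_RI interval_RI smooth_r smooth_k open_I interval_I smooth_R assms
    by - (intro conjI, simp add: stephani_universe_def,
        rule exI[of _ "R ` I"], rule exI[of _ r], rule exI[of _ k], simp,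
        simp add: stephani_universe_def)
qed

end

text \<open>\<open>J\<close> may be larger than R(I). On R(I) the given \<rho> and \<kappa> coincide
  with the energy density and K rebuilt from functions of t, and since R(I) is open so do their
  derivatives.\<close>

lemma strict_of_solution:
  assumes "obtained_from_solution \<epsilon> I R K D"
  shows "strict_nonisoenergetic_universe \<epsilon> I R K D \<and>
    ideal_gas_equations (R ` I) (as_fun_of_R I R (energy_density \<epsilon> R K)) (as_fun_of_R I R K)"
proof -
  from assms obtain J \<rho> \<kappa> where \<epsilon>: "\<epsilon> \<in> {1, 0, -1}" and J: "open J" "J \<subseteq> {0<..}"
    and smooth: "smooth_on J \<rho>" "smooth_on J \<kappa>"
    and nz: "\<forall>s\<in>J. \<rho> s \<noteq> 0 \<and> deriv \<rho> s \<noteq> 0 \<and> deriv \<kappa> s \<noteq> 0"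
    and eqs: "ideal_gas_equations J \<rho> \<kappa>"
    and I: "open I" "is_interval I" and R: "smooth_on I R" "R ` I \<subseteq> J"
    and friedmann: "\<forall>t\<in>I. deriv R t \<noteq> 0 \<and>
       \<rho> (R t) = 3 / (R t)\<^sup>2 * (deriv R t)\<^sup>2 + 3 / (R t)\<^sup>2 * (\<epsilon> - (\<kappa> (R t))\<^sup>2) \<and> K t = \<kappa> (R t)"
    and D: "stephani_domain \<epsilon> I R K D"
    unfolding obtained_from_solution_def by (elim conjE exE)
  have "smooth_on I K"
    by (rule smooth_on_cong[OF I(1) smooth_on_compose[OF I(1) R(1) smooth(2) R(2)]])
      (simp add: friedmann)
  then have U: "stephani_universe \<epsilon> I R K D"
    unfolding stephani_universe_def using \<epsilon> I R J friedmann D by (auto simp: subset_iff)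
  interpret stephani \<epsilon> I R K D by unfold_locales (fact U)
  have energy: "energy_density \<epsilon> R K t = \<rho> (R t)" if "t \<in> I" for t
    using that friedmann by (simp add: energy_density_def)
  have r: "of_R (energy_density \<epsilon> R K) s = \<rho> s" and k: "of_R K s = \<kappa> s" if "s \<in> R ` I" for s
    using that friedmann energy by auto
  note r' = deriv_eq_on_open[OF open_RI r] and k' = deriv_eq_on_open[OF open_RI k]
  have "strict_nonisoenergetic_universe \<epsilon> I R K D"
    unfolding strict_nonisoenergetic_universe_def
  proof (intro conjI ballI)
    show "deriv (of_R K) s \<noteq> 0" if "s \<in> R ` I" for s
    proof -
      have "s \<in> J" using R(2) that by blast
      then show ?thesis using k'[OF _ that] nz by simp
    qed
    fix q assume q: "q \<in> D"
    have RJ: "R (fst q) \<in> R ` I" "R (fst q) \<in> J" using R(2) fst_in_I[OF q] by auto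
    show "udot \<epsilon> I R K (rho \<epsilon> R K) q \<noteq> 0"
      using lapse_nz[OF q] R'_nz[OF fst_in_I[OF q]] nz RJ(2) r'[OF _ RJ(1)]
      by (simp add: udot_def partial_t_rho[OF q])
    show "rho \<epsilon> R K q \<noteq> 0"
      using nz RJ energy[OF fst_in_I[OF q]] by (simp add: rho_def)
  qed (fact U)
  moreover have "ideal_gas_equations (R ` I) \<rho> \<kappa>"
    unfolding ideal_gas_equations_def
    by (intro ballI bspec[OF eqs[unfolded ideal_gas_equations_def]] subsetD[OF R(2)])
  then have "ideal_gas_equations (R ` I) (of_R (energy_density \<epsilon> R K)) (of_R K)"
    by (rule ideal_gas_equations_cong[OF open_RI, rotated 2]) (simp_all only: r k)
  ultimately show ?thesis by blast
qed

lemma strict_stephani_iff: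
  "strict_stephani \<epsilon> I R K D \<longleftrightarrow> strict_nonisoenergetic_universe \<epsilon> I R K D"
  by (auto simp: strict_stephani_def stephani_def strict_stephani_axioms_def
      strict_nonisoenergetic_universe_def)

theorem mainTheorem1:
  fixes \<epsilon> :: real and I :: "real set" and R K :: "real \<Rightarrow> real" and D :: "event set"
  shows
    "(strict_nonisoenergetic_universe \<epsilon> I R K D \<longrightarrow>
        (ideal_gas_condition \<epsilon> I R K D \<longleftrightarrow>
         ideal_gas_equations (R ` I) (as_fun_of_R I R (energy_density \<epsilon> R K)) (as_fun_of_R I R K))) \<and>
     (strict_nonisoenergetic_universe \<epsilon> I R K D \<and> ideal_gas_condition \<epsilon> I R K D \<longleftrightarrow>
        obtained_from_solution \<epsilon> I R K D) \<and>
     (strict_nonisoenergetic_universe \<epsilon> I R K D \<and> ideal_gas_condition \<epsilon> I R K D \<longrightarrow>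
        (\<exists>\<alpha> \<beta> \<gamma> :: real. \<alpha> + \<beta> = \<gamma> - 2 / 3 \<and>
           (\<forall>q\<in>D. chi_fun \<epsilon> I R K q =
                    \<alpha> * (pi_fun \<epsilon> I R K q)\<^sup>2 + \<gamma> * pi_fun \<epsilon> I R K q + \<beta>)))"
proof -
  have strict: "(ideal_gas_condition \<epsilon> I R K D \<longleftrightarrow>
      ideal_gas_equations (R ` I) (as_fun_of_R I R (energy_density \<epsilon> R K)) (as_fun_of_R I R K)) \<and>
      (ideal_gas_condition \<epsilon> I R K D \<longrightarrow> obtained_from_solution \<epsilon> I R K D)"
    if "strict_nonisoenergetic_universe \<epsilon> I R K D"
  proof -
    interpret strict_stephani \<epsilon> I R K D using that by (simp add: strict_stephani_iff)
    show ?thesis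
      using ideal_gas_condition_iff ideal_gas_equations_iff obtained_from_solution_if_equations
      unfolding r_def k_def by simp
  qed
  show ?thesis
  proof (intro conjI impI)
    \<comment> \<open>A solution yields strictness and the equations on R(I); the equivalence in
      \<open>strict\<close> then turns the equations back into the ideal gas condition.\<close>
    show "strict_nonisoenergetic_universe \<epsilon> I R K D \<and> ideal_gas_condition \<epsilon> I R K D \<longleftrightarrow>
        obtained_from_solution \<epsilon> I R K D"
      using strict strict_of_solution[of \<epsilon> I R K D] by argo
    assume *: "strict_nonisoenergetic_universe \<epsilon> I R K D \<and> ideal_gas_condition \<epsilon> I R K D"
    then have "strict_stephani \<epsilon> I R K D" by (simp add: strict_stephani_iff)
    then show "\<exists>\<alpha> \<beta> \<gamma> :: real. \<alpha> + \<beta> = \<gamma> - 2 / 3 \<and>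
           (\<forall>q\<in>D. chi_fun \<epsilon> I R K q =
                    \<alpha> * (pi_fun \<epsilon> I R K q)\<^sup>2 + \<gamma> * pi_fun \<epsilon> I R K q + \<beta>)"
      using * by (intro strict_stephani.chi_quadratic) simp_all
  qed (use strict in simp)
qed

end
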